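(* Let $\{x_i\}_{i=1}^N$ be a solution to the delayed Hegselmann--Krause system $$\frac{dx_i(t)}{dt}=\frac{\lambda}{N}\sum_{j\neq i} a_{ij}(t)\,\bigl(x_j(t-\tau(t))-x_i(t)\bigr),\quad i=1,\dots,N,\ t>0,$$ with initial data $x_i(s)=x_{i,0}(s)$ for $s\in[-\tau(0),0]$, where the $x_{i,0}:[-\tau(0),0]\to\mathbb{R}^d$ are continuous and the communication rates $a_{ij}$ are given by either of the two choices (A) or (B) described in the context. Let $$R=\max_{s\in[-\tau(0),0]}\ \max_{1\le i\le N}|x_i(s)|.$$ Suppose that $$\overline\tau<\ln\left(1+\frac{\psi^3(2R)}{2+\psi^2(2R)}\,\frac{1-c}{\lambda}\right).$$ Then there exist constants $\gamma, C>0$ such that $$d_X(t)\le C e^{-\gamma t},\quad \forall\, t\ge 0,$$ where $d_X(t):=\max_{1\le i,j\le N}|x_i(t)-x_j(t)|$.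
   Context: Here $x_i(t)\in\mathbb{R}^d$, $\lambda>0$ is a constant, and $\psi:[0,+\infty)\to(0,+\infty)$ is a non-increasing function with $\psi(0)=1$. The communication rates $a_{ij}(t)$ are either (A) $a_{ij}(t)=\psi(|x_j(t-\tau(t))-x_i(t)|)$, or (B) $a_{ij}(t)=\dfrac{N\,\psi(|x_j(t-\tau(t))-x_i(t)|)}{\sum_{k=1}^N\psi(|x_k(t-\tau(t))-x_i(t)|)}$. The time delay $\tau(\cdot)$ belongs to $W^{1,\infty}_{loc}(0,+\infty)$ and satisfies $0\le\tau(t)\le\overline\tau$ and $\tau'(t)\le c$ for all $t>0$ (the latter in the almost-everywhere sense), with constants $\overline\tau$ and $c\in(0,1)$; $\tau(0)$ denotes the value of $\tau$ at $0$ (by continuity). In particular $t-\tau(t)\ge-\tau(0)$ for $t\ge0$. Solutions are continuous on $[-\tau(0),+\infty)$. The notation $\psi^k(2R)$ means $(\psi(2R))^k$. *)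

theory Defs
  imports "HOL-Analysis.Analysis"
begin

text \<open>
  Sobolev regularity of the delay. The test functions are those of class C^1 with compact support
  in the open set S; for locally integrable functions on an interval they define the same weak
  derivative as smooth test functions.
\<close>

definition Linf_loc :: "real set \<Rightarrow> (real \<Rightarrow> real) \<Rightarrow> bool" where
  "Linf_loc S f \<longleftrightarrow>
     f \<in> borel_measurable (lebesgue_on S) \<and>
     (\<forall>K. compact K \<and> K \<subseteq> S \<longrightarrow> (\<exists>B. AE t in lebesgue_on K. \<bar>f t\<bar> \<le> B))"

definition C1_test_function :: "real set \<Rightarrow> (real \<Rightarrow> real) \<Rightarrow> (real \<Rightarrow> real) \<Rightarrow> bool" where
  "C1_test_function S \<phi> \<phi>' \<longleftrightarrow>
     (\<forall>t. (\<phi> has_real_derivative \<phi>' t) (at t)) \<and> continuous_on UNIV \<phi>' \<and>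
     compact (closure {t. \<phi> t \<noteq> 0}) \<and> closure {t. \<phi> t \<noteq> 0} \<subseteq> S"

definition weak_derivative_on :: "real set \<Rightarrow> (real \<Rightarrow> real) \<Rightarrow> (real \<Rightarrow> real) \<Rightarrow> bool" where
  "weak_derivative_on S f f' \<longleftrightarrow>
     (\<forall>\<phi> \<phi>'. C1_test_function S \<phi> \<phi>' \<longrightarrow>
        (\<integral>t. f t * \<phi>' t \<partial>lebesgue_on S) = - (\<integral>t. f' t * \<phi> t \<partial>lebesgue_on S))"

text \<open>The function \<open>f\<close> belongs to W^{1,\<infinity>}_loc(S), with weak derivative \<open>f'\<close>.\<close>

definition W1inf_loc :: "real set \<Rightarrow> (real \<Rightarrow> real) \<Rightarrow> (real \<Rightarrow> real) \<Rightarrow> bool" where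
  "W1inf_loc S f f' \<longleftrightarrow> Linf_loc S f \<and> Linf_loc S f' \<and> weak_derivative_on S f f'"

text \<open>
  Agents are indexed by \<open>{1..N}\<close>; \<open>x i t\<close> is the opinion of agent \<open>i\<close> at time \<open>t\<close>. The sum in
  \<open>comm_rate_B\<close> includes \<open>k = i\<close>.
\<close>

definition comm_rate_A ::
    "(real \<Rightarrow> real) \<Rightarrow> (real \<Rightarrow> real) \<Rightarrow> (nat \<Rightarrow> real \<Rightarrow> real ^ 'd) \<Rightarrow> nat \<Rightarrow> nat \<Rightarrow> real \<Rightarrow> real" where
  "comm_rate_A \<psi> \<tau> x i j t = \<psi> (norm (x j (t - \<tau> t) - x i t))"

definition comm_rate_B ::
    "nat \<Rightarrow> (real \<Rightarrow> real) \<Rightarrow> (real \<Rightarrow> real) \<Rightarrow> (nat \<Rightarrow> real \<Rightarrow> real ^ 'd) \<Rightarrow> nat \<Rightarrow> nat \<Rightarrow> real \<Rightarrow> real" where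
  "comm_rate_B N \<psi> \<tau> x i j t =
     real N * \<psi> (norm (x j (t - \<tau> t) - x i t)) /
       (\<Sum>k = 1..N. \<psi> (norm (x k (t - \<tau> t) - x i t)))"

definition HK_solution ::
    "nat \<Rightarrow> real \<Rightarrow> (nat \<Rightarrow> nat \<Rightarrow> real \<Rightarrow> real) \<Rightarrow> (real \<Rightarrow> real) \<Rightarrow>
     (nat \<Rightarrow> real \<Rightarrow> real ^ 'd) \<Rightarrow> (nat \<Rightarrow> real \<Rightarrow> real ^ 'd) \<Rightarrow> bool" where
  "HK_solution N lam a \<tau> x\<^sub>0 x \<longleftrightarrow>
     (\<forall>i\<in>{1..N}.
        continuous_on {- \<tau> 0..} (x i) \<and>
        (\<forall>s\<in>{- \<tau> 0..0}. x i s = x\<^sub>0 i s) \<and>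
        (\<forall>t>0. (x i has_vector_derivative
           (lam / real N) *\<^sub>R (\<Sum>j\<in>{1..N} - {i}. a i j t *\<^sub>R (x j (t - \<tau> t) - x i t))) (at t)))"

text \<open>
  The supremum over \<open>s\<close> is a maximum, since the initial data are continuous on a compact interval.
\<close>

definition initial_radius :: "nat \<Rightarrow> (real \<Rightarrow> real) \<Rightarrow> (nat \<Rightarrow> real \<Rightarrow> real ^ 'd) \<Rightarrow> real" where
  "initial_radius N \<tau> x = (SUP s\<in>{- \<tau> 0..0}. MAX i\<in>{1..N}. norm (x i s))"

definition opinion_diameter :: "nat \<Rightarrow> (nat \<Rightarrow> real \<Rightarrow> real ^ 'd) \<Rightarrow> real \<Rightarrow> real" where
  "opinion_diameter N x t = (MAX (i, j)\<in>{1..N} \<times> {1..N}. norm (x i t - x j t))"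

end

theory Submission
  imports Defs
begin

text \<open>
  The proof contracts the range of the opinions over time windows. In every direction \<open>v\<close> the
  projections \<open>x\<^sub>i \<bullet> v\<close> obey a scalar equation of the same kind, in which each agent moves towards
  delayed values of the others with total weight at most \<open>\<lambda>\<close>. Hence the maximum \<open>M\<close> and the minimum
  of all projections over a time window that is at least as long as any delay are respected by all
  later projections (\<open>projection_le\<close>). In particular all positions stay in a fixed ball, distances are bounded, and
  every communication weight is at least some constant \<open>\<beta> > 0\<close>.
  
  Let \<open>D\<close> bound the range over the window before \<open>t\<^sub>0\<close>. Any chosen agent is at time \<open>t\<^sub>0\<close> in the lower
  or in the upper half of the range; by symmetry, take the lower half. Its distance to \<open>M\<close>
  decays at most exponentially with rate \<open>\<lambda>\<close>, so over a time \<open>3 * T\<close>, where \<open>T > 0\<close> bounds the delay,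
  it remains at least a fixed fraction of \<open>D\<close>. All other agents feel this gap through a weight of
  at least \<open>\<beta>\<close> once their delayed times lie after \<open>t\<^sub>0\<close>, and after a further time \<open>T\<close> each of them is
  also a fixed fraction of \<open>D\<close> below \<open>M\<close> (\<open>projection_contraction\<close>). The fraction does not depend on
  \<open>v\<close>, so the diameter of the set of all positions occupied in a window shrinks by a fixed factor
  from one period \<open>3 * T\<close> to the next (\<open>window_diameter_contraction\<close>), and this gives exponential
  decay.
  
  The maximum principle can start from the initial data only if delayed times never precede
  \<open>- \<tau> 0\<close>. This is where the bound on the weak derivative of the delay enters: it yields
  \<open>\<tau> t - \<tau> 0 \<le> c * t\<close> (\<open>delayed_time_ge\<close>).
\<close>

section \<open>Growth of a function with bounded weak derivative\<close>

text \<open>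
  The second difference of the \<open>C\<^sup>1\<close> function \<open>r \<mapsto> (max 0 r)\<^sup>2\<close>, normalised: it rises from 0 on
  \<open>r \<le> 0\<close> to 1 on \<open>r \<ge> 2 * e\<close>, and its derivative is the tent of width \<open>2 * e\<close> and unit integral.
\<close>

definition smooth_step :: "real \<Rightarrow> real \<Rightarrow> real" where
  "smooth_step e r = ((max 0 r)\<^sup>2 - 2 * (max 0 (r - e))\<^sup>2 + (max 0 (r - 2 * e))\<^sup>2) / (2 * e\<^sup>2)"

definition tent :: "real \<Rightarrow> real \<Rightarrow> real" where
  "tent e r = (max 0 r - 2 * max 0 (r - e) + max 0 (r - 2 * e)) / e\<^sup>2"

lemma has_derivative_max_0_square:
  "((\<lambda>r::real. (max 0 (r - p))\<^sup>2) has_real_derivative 2 * max 0 (r - p)) (at r)"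
proof -
  consider "r < p" | "r = p" | "r > p" by linarith
  then show ?thesis
  proof cases
    case 1
    have "((\<lambda>r::real. 0) has_real_derivative 0) (at r)" by simp
    then have "((\<lambda>r::real. (max 0 (r - p))\<^sup>2) has_real_derivative 0) (at r)"
      by (rule has_field_derivative_transform_within_open[where S = "{..<p}"]) (use 1 in auto)
    then show ?thesis using 1 by simp
  next
    case 2
    have "((\<lambda>y. (max 0 (y - p))\<^sup>2 / (y - p)) \<longlongrightarrow> 0) (at p)"
    proof (rule Lim_null_comparison)
      show "\<forall>\<^sub>F y in at p. norm ((max 0 (y - p))\<^sup>2 / (y - p)) \<le> \<bar>y - p\<bar>"
        by (rule always_eventually) (auto simp: max_def power2_eq_square)
      show "((\<lambda>y. \<bar>y - p\<bar>) \<longlongrightarrow> 0) (at p)"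
        by (auto intro!: tendsto_eq_intros)
    qed
    then show ?thesis using 2 by (simp add: has_field_derivative_iff)
  next
    case 3
    have "((\<lambda>r::real. (r - p)\<^sup>2) has_real_derivative 2 * (r - p)) (at r)"
      by (auto intro!: derivative_eq_intros)
    then have "((\<lambda>r::real. (max 0 (r - p))\<^sup>2) has_real_derivative 2 * (r - p)) (at r)"
      by (rule has_field_derivative_transform_within_open[where S = "{p<..}"]) (use 3 in auto)
    then show ?thesis using 3 by simp
  qed
qed

lemma has_derivative_smooth_step:
  assumes "0 < e"
  shows "((\<lambda>r. smooth_step e (r - p)) has_real_derivative tent e (r - p)) (at r)"
proof -
  have "((\<lambda>r. ((max 0 (r - p))\<^sup>2 - 2 * (max 0 (r - (p + e)))\<^sup>2 + (max 0 (r - (p + 2 * e)))\<^sup>2)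
            / (2 * e\<^sup>2))
      has_real_derivative
        (2 * max 0 (r - p) - 2 * (2 * max 0 (r - (p + e))) + 2 * max 0 (r - (p + 2 * e)))
            / (2 * e\<^sup>2)) (at r)"
    by (intro DERIV_cdivide DERIV_add DERIV_diff DERIV_cmult has_derivative_max_0_square)
  then show ?thesis
    using assms unfolding smooth_step_def tent_def
    by (simp add: algebra_simps diff_divide_distrib add_divide_distrib)
qed

lemma continuous_tent: "continuous_on UNIV (\<lambda>r. tent e (r - p))"
  unfolding tent_def divide_inverse by (intro continuous_intros)

lemma tent_nonneg: "0 < e \<Longrightarrow> 0 \<le> tent e r"
  unfolding tent_def by (auto simp: max_def)

lemma tent_eq_0: "0 < e \<Longrightarrow> r \<notin> {0..2 * e} \<Longrightarrow> tent e r = 0"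
  unfolding tent_def by (auto simp: max_def)

lemma smooth_step_left: "0 < e \<Longrightarrow> r \<le> 0 \<Longrightarrow> smooth_step e r = 0"
  unfolding smooth_step_def by (auto simp: max_def)

lemma smooth_step_right:
  assumes "0 < e" "2 * e \<le> r" shows "smooth_step e r = 1"
proof -
  have "r\<^sup>2 - 2 * (r - e)\<^sup>2 + (r - 2 * e)\<^sup>2 = 2 * e\<^sup>2"
    by (simp add: power2_eq_square algebra_simps)
  then show ?thesis using assms unfolding smooth_step_def by (simp add: max_def)
qed

lemma smooth_step_mono:
  assumes "0 < e" "r \<le> r'" shows "smooth_step e r \<le> smooth_step e r'"
  using has_derivative_smooth_step[OF assms(1), of 0] tent_nonneg[OF assms(1)] assms(2)
  by (intro DERIV_nonneg_imp_nondecreasing[where f = "smooth_step e"]) auto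

lemma lebesgue_integral_positive_compact_support:
  fixes f :: "real \<Rightarrow> real"
  assumes "0 < a" "continuous_on {a..b} f" "\<And>r. r \<notin> {a..b} \<Longrightarrow> f r = 0"
  shows "integrable (lebesgue_on {0<..}) f"
    and "(\<integral>r. f r \<partial>lebesgue_on {0<..}) = integral {a..b} f"
proof -
  have int: "integrable (lebesgue_on {a..b}) f"
    using assms(2) by (rule continuous_imp_integrable_real)
  have eq: "(\<lambda>r. if r \<in> {a..b} then f r else 0) = f" using assms(3) by auto
  have eq': "(\<lambda>r. if r \<in> {0<..} then f r else 0) = f" using assms(1,3) by fastforce
  have "integrable lebesgue f"
    using int Lebesgue_Measure.integrable_restrict_UNIV[of "{a..b}" f] unfolding eq by simp
  then show "integrable (lebesgue_on {0<..}) f"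
    using Lebesgue_Measure.integrable_restrict_UNIV[of "{0<..}" f] unfolding eq' by simp
  have "(\<integral>r. f r \<partial>lebesgue_on {0<..}) = (\<integral>r. f r \<partial>lebesgue)"
    using Lebesgue_Measure.integral_restrict_UNIV[of "{0<..}" f] unfolding eq' by simp
  also have "\<dots> = (\<integral>r. f r \<partial>lebesgue_on {a..b})"
    using Lebesgue_Measure.integral_restrict_UNIV[of "{a..b}" f] unfolding eq by simp
  also have "\<dots> = integral {a..b} f"
    using int by (rule lebesgue_integral_eq_integral) simp
  finally show "(\<integral>r. f r \<partial>lebesgue_on {0<..}) = integral {a..b} f" .
qed

text \<open>
  Testing with the difference of the smooth steps at \<open>s\<close> and at \<open>t\<close> (a plateau over \<open>[s, t]\<close>),
  whose derivative is the difference of two tents, compares local averages of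
  \<open>h r = f r - c * r\<close>: the bound on the weak derivative says that the average of \<open>h\<close> right
  after \<open>s\<close> is at least the one right after \<open>t\<close>. If \<open>h s < h t\<close>, then by continuity narrow tents
  contradict this.
\<close>

lemma weak_derivative_le_imp_growth_le:
  fixes f f' :: "real \<Rightarrow> real"
  assumes weak: "weak_derivative_on {0<..} f f'" and cont: "continuous_on {0<..} f"
    and le: "AE t in lebesgue_on {0<..}. f' t \<le> c" and "0 \<le> c" and "0 < s" "s \<le> t"
  shows "f t - f s \<le> c * (t - s)"
proof (rule ccontr)
  define h where "h r = f r - c * r" for r
  assume "\<not> ?thesis"
  then have lt: "h s < h t" by (simp add: h_def algebra_simps)
  then have "s < t" using \<open>s \<le> t\<close> by (cases "s = t") auto
  define m1 m2 where "m1 = (2 * h s + h t) / 3" and "m2 = (h s + 2 * h t) / 3"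
  have m: "h s < m1" "m1 < m2" "m2 < h t" using lt by (auto simp: m1_def m2_def)
  have h_cont: "continuous_on {0<..} h"
    unfolding h_def by (intro continuous_intros cont)
  have h_tends: "(h \<longlongrightarrow> h r) (at r)" if "0 < r" for r
    using h_cont that by (simp add: continuous_on_eq_continuous_at isCont_def)
  have "\<forall>\<^sub>F r in at s. h r < m1" "\<forall>\<^sub>F r in at t. m2 < h r"
    using order_tendstoD(2)[OF h_tends[of s]] order_tendstoD(1)[OF h_tends[of t]] m \<open>0 < s\<close> \<open>s < t\<close>
    by auto
  then obtain d1 d2 where d: "0 < d1" "0 < d2"
    "\<And>r. r \<noteq> s \<Longrightarrow> dist r s < d1 \<Longrightarrow> h r < m1" "\<And>r. r \<noteq> t \<Longrightarrow> dist r t < d2 \<Longrightarrow> m2 < h r"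
    unfolding eventually_at by blast
  define e where "e = min d1 d2 / 3"
  have e: "0 < e" "2 * e < d1" "2 * e < d2" using d by (auto simp: e_def)
  have near_s: "h r \<le> m1" if "r \<in> {s..s + 2 * e}" for r
    using d(3)[of r] m e that by (cases "r = s") (auto simp: dist_real_def)
  have near_t: "m2 \<le> h r" if "r \<in> {t..t + 2 * e}" for r
    using d(4)[of r] m e that by (cases "r = t") (auto simp: dist_real_def)
  define b where "b = t + 2 * e"
  define \<phi> where "\<phi> r = smooth_step e (r - s) - smooth_step e (r - t)" for r
  define \<phi>' where "\<phi>' r = tent e (r - s) - tent e (r - t)" for r
  have \<phi>_deriv: "(\<phi> has_real_derivative \<phi>' r) (at r)" for r
    unfolding \<phi>_def \<phi>'_def by (intro DERIV_diff has_derivative_smooth_step e)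
  have \<phi>'_cont: "continuous_on S \<phi>'" for S
    unfolding \<phi>'_def
    by (intro continuous_on_subset[OF continuous_on_diff[OF continuous_tent continuous_tent]]) auto
  have \<phi>_cont: "continuous_on S \<phi>" for S
    using \<phi>_deriv by (meson DERIV_continuous continuous_at_imp_continuous_on)
  have \<phi>_zero: "\<phi> r = 0" if "r \<notin> {s<..<b}" for r
  proof (cases "r \<le> s")
    case True
    then show ?thesis using \<open>s < t\<close> e(1) by (simp add: \<phi>_def smooth_step_left)
  next
    case False
    then show ?thesis using that \<open>s < t\<close> e(1) by (simp add: \<phi>_def b_def smooth_step_right)
  qed
  have \<phi>'_zero: "\<phi>' r = 0" if "r \<notin> {s..b}" for r
    using that \<open>s < t\<close> e(1) by (auto simp: \<phi>'_def b_def tent_eq_0)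
  have \<phi>_nonneg: "0 \<le> \<phi> r" for r
    using smooth_step_mono[OF e(1), of "r - t" "r - s"] \<open>s < t\<close> by (simp add: \<phi>_def)
  have "{r. \<phi> r \<noteq> 0} \<subseteq> {s..b}"
  proof
    fix r assume "r \<in> {r. \<phi> r \<noteq> 0}"
    then have "r \<in> {s<..<b}" using \<phi>_zero[of r] by blast
    then show "r \<in> {s..b}" by simp
  qed
  then have supp: "closure {r. \<phi> r \<noteq> 0} \<subseteq> {s..b}"
    by (rule closure_minimal) simp
  then have "compact (closure {r. \<phi> r \<noteq> 0})"
    by (meson bounded_closed_interval bounded_subset closed_closure compact_eq_bounded_closed)
  then have "C1_test_function {0<..} \<phi> \<phi>'"
    unfolding C1_test_function_def using \<phi>_deriv \<phi>'_cont supp \<open>0 < s\<close> by force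
  then have parts: "(\<integral>r. f r * \<phi>' r \<partial>lebesgue_on {0<..}) = - (\<integral>r. f' r * \<phi> r \<partial>lebesgue_on {0<..})"
    using weak unfolding weak_derivative_on_def by blast
  have f_cont: "continuous_on {s..b} f"
    using cont \<open>0 < s\<close> by (auto intro: continuous_on_subset)
  (* Where f' * \<phi> fails to be integrable, its integral is 0 by convention, which does not
     exceed the nonnegative right-hand side. *)
  have "(\<integral>r. f' r * \<phi> r \<partial>lebesgue_on {0<..}) \<le> (\<integral>r. c * \<phi> r \<partial>lebesgue_on {0<..})"
  proof (rule integral_mono_AE')
    show "integrable (lebesgue_on {0<..}) (\<lambda>r. c * \<phi> r)"
      using \<phi>_zero \<open>0 < s\<close>
      by (intro lebesgue_integral_positive_compact_support(1)[of s b] continuous_intros \<phi>_cont) auto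
    show "AE r in lebesgue_on {0<..}. f' r * \<phi> r \<le> c * \<phi> r"
      using le by eventually_elim (use \<phi>_nonneg in \<open>auto intro: mult_right_mono\<close>)
    show "AE r in lebesgue_on {0<..}. 0 \<le> c * \<phi> r"
      using \<phi>_nonneg \<open>0 \<le> c\<close> by simp
  qed
  also have "\<dots> = integral {s..b} (\<lambda>r. c * \<phi> r)"
    using \<phi>_zero \<open>0 < s\<close>
    by (intro lebesgue_integral_positive_compact_support(2) continuous_intros \<phi>_cont) auto
  finally have upper: "(\<integral>r. f' r * \<phi> r \<partial>lebesgue_on {0<..}) \<le> integral {s..b} (\<lambda>r. c * \<phi> r)" .
  have lower: "(\<integral>r. f r * \<phi>' r \<partial>lebesgue_on {0<..}) = integral {s..b} (\<lambda>r. f r * \<phi>' r)"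
    using \<phi>'_zero \<open>0 < s\<close>
    by (intro lebesgue_integral_positive_compact_support(2) continuous_intros \<phi>'_cont f_cont) auto
  (* The same integration by parts for the linear function c * r, as the derivative of c * r * \<phi>. *)
  have "((\<lambda>r. c * \<phi> r + c * r * \<phi>' r) has_integral (c * b * \<phi> b - c * s * \<phi> s)) {s..b}"
  proof (rule fundamental_theorem_of_calculus)
    show "s \<le> b" using \<open>s < t\<close> e by (simp add: b_def)
    show "((\<lambda>r. c * r * \<phi> r) has_vector_derivative c * \<phi> r + c * r * \<phi>' r) (at r within {s..b})" for r
      unfolding has_real_derivative_iff_has_vector_derivative[symmetric]
      by (rule has_field_derivative_at_within)
        (auto intro!: derivative_eq_intros \<phi>_deriv simp: algebra_simps)
  qed
  then have moment: "((\<lambda>r. c * \<phi> r + c * r * \<phi>' r) has_integral 0) {s..b}"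
    using \<phi>_zero[of s] \<phi>_zero[of b] by simp
  have i1: "(\<lambda>r. f r * \<phi>' r) integrable_on {s..b}"
    by (intro integrable_continuous_interval continuous_intros \<phi>'_cont f_cont)
  have i2: "(\<lambda>r. c * \<phi> r) integrable_on {s..b}"
    by (intro integrable_continuous_interval continuous_intros \<phi>_cont)
  have "((\<lambda>r. f r * \<phi>' r + c * \<phi> r - (c * \<phi> r + c * r * \<phi>' r)) has_integral
      (integral {s..b} (\<lambda>r. f r * \<phi>' r) + integral {s..b} (\<lambda>r. c * \<phi> r) - 0)) {s..b}"
    by (intro has_integral_diff has_integral_add integrable_integral i1 i2 moment)
  then have hint: "((\<lambda>r. h r * \<phi>' r) has_integral
      (integral {s..b} (\<lambda>r. f r * \<phi>' r) + integral {s..b} (\<lambda>r. c * \<phi> r))) {s..b}"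
    by (simp add: h_def algebra_simps)
  have tent_int: "((\<lambda>r. tent e (r - p)) has_integral 1) {s..b}" if "p \<in> {s, t}" for p
  proof -
    have "((\<lambda>r. tent e (r - p)) has_integral (smooth_step e (b - p) - smooth_step e (s - p))) {s..b}"
    proof (rule fundamental_theorem_of_calculus)
      show "s \<le> b" using \<open>s < t\<close> e by (simp add: b_def)
      show "((\<lambda>r. smooth_step e (r - p)) has_vector_derivative tent e (r - p)) (at r within {s..b})" for r
        unfolding has_real_derivative_iff_has_vector_derivative[symmetric]
        by (rule has_field_derivative_at_within) (rule has_derivative_smooth_step[OF e(1)])
    qed
    moreover have "smooth_step e (s - p) = 0" "smooth_step e (b - p) = 1"
      using that \<open>s < t\<close> e by (auto simp: b_def smooth_step_left smooth_step_right)
    ultimately show ?thesis by simp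
  qed
  have "((\<lambda>r. m1 * tent e (r - s) - m2 * tent e (r - t)) has_integral (m1 * 1 - m2 * 1)) {s..b}"
    by (intro has_integral_diff has_integral_mult_right tent_int) auto
  with hint have "integral {s..b} (\<lambda>r. f r * \<phi>' r) + integral {s..b} (\<lambda>r. c * \<phi> r) \<le> m1 * 1 - m2 * 1"
  proof (rule has_integral_le)
    fix r
    have "h r * tent e (r - s) \<le> m1 * tent e (r - s)"
      using near_s[of r] tent_nonneg[OF e(1), of "r - s"] tent_eq_0[OF e(1), of "r - s"]
      by (cases "r \<in> {s..s + 2 * e}") (auto intro: mult_right_mono)
    moreover have "m2 * tent e (r - t) \<le> h r * tent e (r - t)"
      using near_t[of r] tent_nonneg[OF e(1), of "r - t"] tent_eq_0[OF e(1), of "r - t"]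
      by (cases "r \<in> {t..t + 2 * e}") (auto intro: mult_right_mono)
    ultimately show "h r * \<phi>' r \<le> m1 * tent e (r - s) - m2 * tent e (r - t)"
      by (simp add: \<phi>'_def right_diff_distrib)
  qed
  with upper lower parts m show False by linarith
qed

text \<open>
  The delay grows at rate at most \<open>c \<le> 1\<close>, hence delayed times never precede the start of the
  history: the dynamics only ever sees the prescribed initial data.
\<close>

lemma delayed_time_ge:
  fixes \<tau> \<tau>' :: "real \<Rightarrow> real"
  assumes "weak_derivative_on {0<..} \<tau> \<tau>'" and cont: "continuous_on {0..} \<tau>"
    and "AE t in lebesgue_on {0<..}. \<tau>' t \<le> c" and "0 \<le> c" and "c \<le> 1" and "0 < t"
  shows "- \<tau> 0 \<le> t - \<tau> t"
proof -
  have "(\<tau> \<longlongrightarrow> \<tau> 0) (at_right 0)"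
    using cont unfolding continuous_on_def
    by (metis at_within_Ici_at_right atLeast_iff order_refl)
  moreover have "\<forall>\<^sub>F s in at_right 0. \<tau> t - c * t \<le> \<tau> s"
  proof (rule eventually_at_rightI)
    show "0 < t" by fact
    fix s assume s: "s \<in> {0<..<t}"
    have "\<tau> t - \<tau> s \<le> c * (t - s)"
      using assms s by (intro weak_derivative_le_imp_growth_le continuous_on_subset[OF cont]) auto
    moreover have "0 \<le> c * s" using s \<open>0 \<le> c\<close> by simp
    ultimately show "\<tau> t - c * t \<le> \<tau> s" by (simp add: algebra_simps)
  qed
  ultimately have "\<tau> t - c * t \<le> \<tau> 0"
    by (intro tendsto_lowerbound) auto
  moreover have "c * t \<le> t" using assms by simp
  ultimately show ?thesis by linarith
qed

section \<open>A maximum principle for delayed averaging\<close>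

lemma linear_relaxation_lower_bound:
  fixes u u' :: "real \<Rightarrow> real"
  assumes "p \<le> q" "K > 0" "continuous_on {p..q} u"
    and deriv: "\<And>t. p < t \<Longrightarrow> t < q \<Longrightarrow> (u has_real_derivative u' t) (at t)"
    and ge: "\<And>t. p < t \<Longrightarrow> t < q \<Longrightarrow> r - K * u t \<le> u' t"
  shows "exp (- K * (q - p)) * u p + r / K * (1 - exp (- K * (q - p))) \<le> u q"
proof -
  define w where "w t = exp (K * t) * (u t - r / K)" for t
  have "w p \<le> w q"
  proof (rule DERIV_nonneg_imp_increasing_open[OF \<open>p \<le> q\<close>])
    fix t assume t: "p < t" "t < q"
    have "(w has_real_derivative exp (K * t) * (u' t - (r - K * u t))) (at t)"
      unfolding w_def using \<open>K > 0\<close>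
      by (auto intro!: derivative_eq_intros deriv[OF t] simp: field_simps)
    then show "\<exists>y. (w has_real_derivative y) (at t) \<and> 0 \<le> y"
      using ge[OF t] by fastforce
  next
    show "continuous_on {p..q} w"
      unfolding w_def by (intro continuous_intros assms)
  qed
  then have "exp (- K * q) * (exp (K * p) * (u p - r / K)) \<le> exp (- K * q) * (exp (K * q) * (u q - r / K))"
    unfolding w_def by (intro mult_left_mono) auto
  moreover have "exp (- K * q) * exp (K * p) = exp (- K * (q - p))"
    "exp (- K * q) * exp (K * q) = 1"
    by (simp_all add: exp_add[symmetric] algebra_simps)
  ultimately have "exp (- K * (q - p)) * (u p - r / K) \<le> u q - r / K"
    by (metis mult.assoc mult_1)
  then show ?thesis by (simp add: algebra_simps)
qed

lemma norm_le_if_unit_projections_le: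
  fixes y :: "'a::real_inner"
  assumes "0 \<le> D" and "\<And>v. norm v = 1 \<Longrightarrow> y \<bullet> v \<le> D"
  shows "norm y \<le> D"
proof (cases "y = 0")
  case False
  then have "y \<bullet> sgn y \<le> D" by (intro assms(2)) (simp add: norm_sgn)
  moreover have "y \<bullet> sgn y = norm y"
    using False by (simp add: sgn_div_norm power2_norm_eq_inner[symmetric] power2_eq_square)
  ultimately show ?thesis by simp
qed (use assms in simp)

text \<open>
  Weighted averaging towards delayed positions, with total weight at most \<open>K\<close>; \<open>- h\<close> is the start
  of the history and \<open>T\<close> bounds the delay. Normalised and unnormalised communication rates differ
  only in the weights \<open>b\<close>, so that both are covered by this abstraction.
\<close>

locale delayed_averaging =
  fixes I :: "'i set" and K T h :: real and \<tau> :: "real \<Rightarrow> real"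
    and b :: "'i \<Rightarrow> 'i \<Rightarrow> real \<Rightarrow> real" and x :: "'i \<Rightarrow> real \<Rightarrow> 'a::real_inner"
  assumes finite_I: "finite I" and K_pos: "0 < K" and T_pos: "0 < T" and h_nonneg: "0 \<le> h"
    and h_le: "h \<le> T"
    and delay: "0 < t \<Longrightarrow> 0 \<le> \<tau> t \<and> \<tau> t \<le> T \<and> - h \<le> t - \<tau> t"
    and cont: "i \<in> I \<Longrightarrow> continuous_on {- h..} (x i)"
    and deriv: "i \<in> I \<Longrightarrow> 0 < t \<Longrightarrow>
      (x i has_vector_derivative (\<Sum>j\<in>I - {i}. b i j t *\<^sub>R (x j (t - \<tau> t) - x i t))) (at t)"
    and weight_nonneg: "i \<in> I \<Longrightarrow> j \<in> I \<Longrightarrow> 0 < t \<Longrightarrow> 0 \<le> b i j t"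
    and weight_sum_le: "i \<in> I \<Longrightarrow> 0 < t \<Longrightarrow> (\<Sum>j\<in>I - {i}. b i j t) \<le> K"
begin

text \<open>
  The time interval whose states determine the future after \<open>t\<^sub>0\<close>, cut off where the history
  begins.
\<close>

definition window :: "real \<Rightarrow> real set" where
  "window t\<^sub>0 = {max (- h) (t\<^sub>0 - T)..t\<^sub>0}"

lemma window_mem: "0 \<le> t\<^sub>0 \<Longrightarrow> t\<^sub>0 \<in> window t\<^sub>0"
  using h_nonneg T_pos by (auto simp: window_def)

lemma projection_deriv:
  assumes "i \<in> I" "0 < t"
  shows "((\<lambda>t. x i t \<bullet> v) has_real_derivative
    (\<Sum>j\<in>I - {i}. b i j t * (x j (t - \<tau> t) \<bullet> v - x i t \<bullet> v))) (at t)"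
proof -
  have "((\<lambda>t. x i t \<bullet> v) has_vector_derivative
    (\<Sum>j\<in>I - {i}. b i j t *\<^sub>R (x j (t - \<tau> t) - x i t)) \<bullet> v) (at t)"
    using deriv[OF assms] bounded_linear.has_vector_derivative[OF bounded_linear_inner_left] by blast
  then show ?thesis
    by (simp add: has_real_derivative_iff_has_vector_derivative inner_sum_left inner_diff_left)
qed

text \<open>
  Maximum principle. Subtract a small drift \<open>\<eta> * s\<close> and take the agent and the time at which the
  tilted projection is largest after \<open>t\<^sub>0\<close>. If the projection there exceeded \<open>M\<close>, then no delayed
  position would lie above it, so its derivative would be at most \<open>0\<close> and the tilted projection
  would have been larger just before. The tilt is what turns the weak inequality into a
  contradiction, and it works equally where the delay vanishes.
\<close>

lemma projection_le:
  assumes "0 \<le> t\<^sub>0" and hist: "\<And>j s. j \<in> I \<Longrightarrow> s \<in> window t\<^sub>0 \<Longrightarrow> x j s \<bullet> v \<le> M"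
    and "i \<in> I" "- h \<le> t" "t\<^sub>0 - T \<le> t"
  shows "x i t \<bullet> v \<le> M"
proof (cases "t \<le> t\<^sub>0")
  case True
  then show ?thesis using assms by (auto simp: window_def)
next
  case False
  show ?thesis
  proof (rule field_le_epsilon)
    fix e :: real assume "0 < e"
    define \<eta> where "\<eta> = e / (t - t\<^sub>0)"
    have \<eta>: "0 < \<eta>" "\<eta> * (t - t\<^sub>0) = e" using False \<open>0 < e\<close> by (auto simp: \<eta>_def)
    define g where "g j s = x j s \<bullet> v - \<eta> * s" for j s
    have "\<exists>p\<in>{t\<^sub>0..t}. \<forall>s\<in>{t\<^sub>0..t}. g j s \<le> g j p" if "j \<in> I" for j
    proof (rule continuous_attains_sup)
      have "continuous_on {t\<^sub>0..t} (x j)"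
        by (rule continuous_on_subset[OF cont[OF that]]) (use \<open>0 \<le> t\<^sub>0\<close> h_nonneg in auto)
      then show "continuous_on {t\<^sub>0..t} (g j)"
        unfolding g_def by (intro continuous_intros)
    qed (use False in auto)
    then obtain p where p: "\<And>j. j \<in> I \<Longrightarrow> p j \<in> {t\<^sub>0..t}"
      "\<And>j s. j \<in> I \<Longrightarrow> s \<in> {t\<^sub>0..t} \<Longrightarrow> g j s \<le> g j (p j)"
      by metis
    obtain k where k: "k \<in> I" "\<And>j. j \<in> I \<Longrightarrow> g j (p j) \<le> g k (p k)"
    proof -
      have "finite ((\<lambda>j. g j (p j)) ` I)" "(\<lambda>j. g j (p j)) ` I \<noteq> {}"
        using finite_I \<open>i \<in> I\<close> by auto
      then obtain k where "k \<in> I" "Max ((\<lambda>j. g j (p j)) ` I) = g k (p k)"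
        by (meson Max_in imageE)
      moreover have "g j (p j) \<le> Max ((\<lambda>j. g j (p j)) ` I)" if "j \<in> I" for j
        using finite_I that by (intro Max_ge) auto
      ultimately show ?thesis using that by auto
    qed
    define q where "q = p k"
    have q: "t\<^sub>0 \<le> q" "q \<le> t" using p(1)[OF k(1)] by (auto simp: q_def)
    have g_max: "g j s \<le> g k q" if "j \<in> I" "s \<in> {t\<^sub>0..t}" for j s
      using p(2)[OF that] k(2)[OF that(1)] by (simp add: q_def)
    have "x k q \<bullet> v \<le> M"
    proof (cases "q = t\<^sub>0")
      case True
      then show ?thesis using hist[OF k(1)] window_mem \<open>0 \<le> t\<^sub>0\<close> by simp
    next
      case q_ne: False
      show ?thesis
      proof (rule ccontr)
        assume above: "\<not> x k q \<bullet> v \<le> M"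
        have "0 < q" "t\<^sub>0 < q" using q_ne q \<open>0 \<le> t\<^sub>0\<close> by auto
        have "x j (q - \<tau> q) \<bullet> v \<le> x k q \<bullet> v" if "j \<in> I" for j
        proof (cases "q - \<tau> q \<le> t\<^sub>0")
          case True
          then have "q - \<tau> q \<in> window t\<^sub>0"
            using delay[OF \<open>0 < q\<close>] q by (auto simp: window_def)
          then show ?thesis using hist[OF that] above by fastforce
        next
          case False
          then have "g j (q - \<tau> q) \<le> g k q"
            using g_max[OF that] delay[OF \<open>0 < q\<close>] q by auto
          moreover have "0 \<le> \<eta> * \<tau> q" using \<eta> delay[OF \<open>0 < q\<close>] by simp
          ultimately show ?thesis by (simp add: g_def algebra_simps)
        qed
        then have "(\<Sum>j\<in>I - {k}. b k j q * (x j (q - \<tau> q) \<bullet> v - x k q \<bullet> v)) \<le> 0"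
          using weight_nonneg[OF k(1) _ \<open>0 < q\<close>]
          by (intro sum_nonpos) (auto intro: mult_nonneg_nonpos)
        moreover have "(g k has_real_derivative
            (\<Sum>j\<in>I - {k}. b k j q * (x j (q - \<tau> q) \<bullet> v - x k q \<bullet> v)) - \<eta>) (at q)"
          unfolding g_def by (auto intro!: derivative_eq_intros projection_deriv[OF k(1) \<open>0 < q\<close>])
        ultimately obtain d where d: "0 < d" "\<And>r. 0 < r \<Longrightarrow> r < d \<Longrightarrow> g k q < g k (q - r)"
          using DERIV_neg_dec_left[of "g k"] \<eta> by (smt (verit))
        define r where "r = min (d / 2) (q - t\<^sub>0)"
        have "0 < r" "r < d" "r \<le> q - t\<^sub>0" using d(1) \<open>t\<^sub>0 < q\<close> by (auto simp: r_def)
        then show False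
          using d(2)[of r] g_max[OF k(1), of "q - r"] q by auto
      qed
    qed
    moreover have "g i t \<le> g k q" using g_max \<open>i \<in> I\<close> False by auto
    moreover have "\<eta> * (t - q) \<le> \<eta> * (t - t\<^sub>0)" using \<eta> q by (intro mult_left_mono) auto
    ultimately show "x i t \<bullet> v \<le> M + e" using \<eta>(2) by (simp add: g_def algebra_simps)
  qed
qed

lemma norm_le:
  assumes "\<And>j s. j \<in> I \<Longrightarrow> s \<in> {- h..0} \<Longrightarrow> norm (x j s) \<le> \<rho>" and "i \<in> I" "- h \<le> t"
  shows "norm (x i t) \<le> \<rho>"
proof (rule norm_le_if_unit_projections_le)
  have "0 \<le> norm (x i 0)" by simp
  also have "\<dots> \<le> \<rho>" using assms h_nonneg by simp
  finally show "0 \<le> \<rho>" .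
  fix v :: 'a assume nv: "norm v = 1"
  show "x i t \<bullet> v \<le> \<rho>"
  proof (rule projection_le[of 0])
    fix j s assume "j \<in> I" "s \<in> window 0"
    then have "norm (x j s) \<le> \<rho>" using assms(1) by (auto simp: window_def)
    then show "x j s \<bullet> v \<le> \<rho>" using norm_cauchy_schwarz[of "x j s" v] nv by simp
  qed (use assms h_le in auto)
qed

text \<open>
  Positions are compared across different times of the window: this is what the delayed
  dynamics can contract, whereas the diameter at equal times need not be monotone.
\<close>

definition window_diameter_le :: "real \<Rightarrow> real \<Rightarrow> bool" where
  "window_diameter_le t\<^sub>0 D \<longleftrightarrow>
     (\<forall>i\<in>I. \<forall>j\<in>I. \<forall>s\<in>window t\<^sub>0. \<forall>t\<in>window t\<^sub>0. norm (x i s - x j t) \<le> D)"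

lemma projection_range:
  assumes "window_diameter_le t\<^sub>0 D" "norm v = 1" "0 \<le> t\<^sub>0" "I \<noteq> {}"
  obtains M where "\<And>j s. j \<in> I \<Longrightarrow> s \<in> window t\<^sub>0 \<Longrightarrow> M - D \<le> x j s \<bullet> v"
    "\<And>j s. j \<in> I \<Longrightarrow> s \<in> window t\<^sub>0 \<Longrightarrow> x j s \<bullet> v \<le> M"
proof
  define S where "S = {x j s \<bullet> v | j s. j \<in> I \<and> s \<in> window t\<^sub>0}"
  have diff: "x i s \<bullet> v \<le> x j t \<bullet> v + D"
    if "i \<in> I" "j \<in> I" "s \<in> window t\<^sub>0" "t \<in> window t\<^sub>0" for i j s t
  proof -
    have "(x i s - x j t) \<bullet> v \<le> norm (x i s - x j t)"
      using norm_cauchy_schwarz[of "x i s - x j t" v] assms(2) by simp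
    also have "\<dots> \<le> D" using assms(1) that by (auto simp: window_diameter_le_def)
    finally show ?thesis by (simp add: inner_diff_left)
  qed
  have "S \<noteq> {}" using assms window_mem by (auto simp: S_def)
  fix j s assume js: "j \<in> I" "s \<in> window t\<^sub>0"
  have le: "y \<le> x j s \<bullet> v + D" if "y \<in> S" for y
    using that diff js by (auto simp: S_def)
  show "Sup S - D \<le> x j s \<bullet> v"
    using cSup_least[OF \<open>S \<noteq> {}\<close> le] by simp
  show "x j s \<bullet> v \<le> Sup S"
    by (rule cSup_upper) (use js le in \<open>auto simp: S_def bdd_above_def\<close>)
qed

lemma window_diameter_le_later:
  assumes "window_diameter_le t\<^sub>0 D" "0 \<le> t\<^sub>0" "i \<in> I" "j \<in> I" "t\<^sub>0 \<le> t"
  shows "norm (x i t - x j t) \<le> D"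
proof (rule norm_le_if_unit_projections_le)
  have "0 \<le> norm (x i t\<^sub>0 - x j t\<^sub>0)" by simp
  also have "\<dots> \<le> D" using assms window_mem by (auto simp: window_diameter_le_def)
  finally show "0 \<le> D" .
  fix v :: 'a assume nv: "norm v = 1"
  obtain M where M: "\<And>j s. j \<in> I \<Longrightarrow> s \<in> window t\<^sub>0 \<Longrightarrow> M - D \<le> x j s \<bullet> v"
    "\<And>j s. j \<in> I \<Longrightarrow> s \<in> window t\<^sub>0 \<Longrightarrow> x j s \<bullet> v \<le> M"
    using projection_range[OF assms(1) nv] assms by blast
  have "x i t \<bullet> v \<le> M"
    by (rule projection_le[of t\<^sub>0]) (use M assms h_nonneg T_pos in auto)
  moreover have "x j t \<bullet> - v \<le> D - M"
    by (rule projection_le[of t\<^sub>0]) (use M assms h_nonneg T_pos in \<open>auto simp: algebra_simps\<close>)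
  ultimately show "(x i t - x j t) \<bullet> v \<le> D" by (simp add: inner_diff_left)
qed

text \<open>
  The gap \<open>M - x i t \<bullet> v\<close> to the maximum decays at rate at most \<open>K\<close>, because the total weight is at
  most \<open>K\<close>, and is replenished by the gaps of the delayed positions that agent \<open>i\<close> sees.
\<close>

lemma gap_lower_bound:
  assumes "0 \<le> t\<^sub>0" and hist: "\<And>j s. j \<in> I \<Longrightarrow> s \<in> window t\<^sub>0 \<Longrightarrow> x j s \<bullet> v \<le> M"
    and "i \<in> I" "t\<^sub>0 \<le> p" "p \<le> q"
    and pull: "\<And>t. p < t \<Longrightarrow> t < q \<Longrightarrow> r \<le> (\<Sum>j\<in>I - {i}. b i j t * (M - x j (t - \<tau> t) \<bullet> v))"
  shows "exp (- K * (q - p)) * (M - x i p \<bullet> v) + r / K * (1 - exp (- K * (q - p))) \<le> M - x i q \<bullet> v"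
proof (rule linear_relaxation_lower_bound[OF \<open>p \<le> q\<close> K_pos,
      where u' = "\<lambda>t. - (\<Sum>j\<in>I - {i}. b i j t * (x j (t - \<tau> t) \<bullet> v - x i t \<bullet> v))"])
  have "continuous_on {p..q} (x i)"
    by (rule continuous_on_subset[OF cont[OF \<open>i \<in> I\<close>]]) (use assms h_nonneg in auto)
  then show "continuous_on {p..q} (\<lambda>t. M - x i t \<bullet> v)"
    by (intro continuous_intros)
next
  fix t assume t: "p < t" "t < q"
  then have "0 < t" using assms by simp
  show "((\<lambda>t. M - x i t \<bullet> v) has_real_derivative
      - (\<Sum>j\<in>I - {i}. b i j t * (x j (t - \<tau> t) \<bullet> v - x i t \<bullet> v))) (at t)"
    by (auto intro!: derivative_eq_intros projection_deriv[OF \<open>i \<in> I\<close> \<open>0 < t\<close>])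
  have "x i t \<bullet> v \<le> M"
    by (rule projection_le[of t\<^sub>0]) (use assms t h_nonneg T_pos in auto)
  then have "(\<Sum>j\<in>I - {i}. b i j t) * (M - x i t \<bullet> v) \<le> K * (M - x i t \<bullet> v)"
    using weight_sum_le[OF \<open>i \<in> I\<close> \<open>0 < t\<close>] by (intro mult_right_mono) auto
  then show "r - K * (M - x i t \<bullet> v)
      \<le> - (\<Sum>j\<in>I - {i}. b i j t * (x j (t - \<tau> t) \<bullet> v - x i t \<bullet> v))"
    using pull[OF t]
    by (simp add: sum_subtractf sum_distrib_left sum_distrib_right algebra_simps)
qed

end

section \<open>Contraction under all-to-all communication\<close>

locale complete_delayed_averaging = delayed_averaging I K T h \<tau> b x
  for I :: "'i set" and K T h and \<tau> :: "real \<Rightarrow> real"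
    and b :: "'i \<Rightarrow> 'i \<Rightarrow> real \<Rightarrow> real" and x :: "'i \<Rightarrow> real \<Rightarrow> 'a::real_inner" +
  fixes \<beta> :: real
  assumes \<beta>_pos: "0 < \<beta>"
    and weight_ge: "i \<in> I \<Longrightarrow> j \<in> I \<Longrightarrow> i \<noteq> j \<Longrightarrow> 0 < t \<Longrightarrow> \<beta> \<le> b i j t"
begin

text \<open>
  An agent in the lower half of the range at time \<open>t\<^sub>0\<close> keeps at least this fraction of the
  range as its gap to the maximum until \<open>t\<^sub>0 + 3 * T\<close>.
\<close>

definition leader_gap :: real where
  "leader_gap = exp (- K * (3 * T)) / 2"

text \<open>
  The first entry is the gap of the leader itself, the second the gap that the pull of the
  leader creates in every other agent during a time \<open>T\<close>.
\<close>

definition contraction :: real where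
  "contraction = min leader_gap (\<beta> * leader_gap / K * (1 - exp (- K * T)))"

lemma contraction_pos: "0 < contraction"
  using \<beta>_pos K_pos T_pos by (simp add: contraction_def leader_gap_def)

lemma contraction_le_half: "contraction \<le> 1 / 2"
proof -
  have "leader_gap \<le> 1 / 2" using K_pos T_pos by (simp add: leader_gap_def)
  then show ?thesis unfolding contraction_def by (rule min.coboundedI1)
qed

text \<open>
  One agent \<open>k\<close> below the midpoint stays away from the maximum throughout. From \<open>t\<^sub>0 + T\<close> on all
  delayed times are later than \<open>t\<^sub>0\<close>, so every other agent sees this gap with weight at least \<open>\<beta>\<close>.
  By \<open>t\<^sub>0 + 2 * T\<close>, where the next full window begins, everyone has acquired a definite gap.
\<close>

lemma projection_contraction:
  assumes "0 \<le> t\<^sub>0" "0 \<le> D" and hist: "\<And>j s. j \<in> I \<Longrightarrow> s \<in> window t\<^sub>0 \<Longrightarrow> x j s \<bullet> v \<le> M"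
    and k: "k \<in> I" "x k t\<^sub>0 \<bullet> v \<le> M - D / 2"
    and i: "i \<in> I" "t \<in> window (t\<^sub>0 + 3 * T)"
  shows "x i t \<bullet> v \<le> M - contraction * D"
proof -
  have t: "t\<^sub>0 + 2 * T \<le> t" "t \<le> t\<^sub>0 + 3 * T" using i(2) by (auto simp: window_def)
  have below: "x j s \<bullet> v \<le> M" if "j \<in> I" "- h \<le> s" "t\<^sub>0 - T \<le> s" for j s
    using projection_le[OF \<open>0 \<le> t\<^sub>0\<close> hist] that by blast
  have leader: "leader_gap * D \<le> M - x k s \<bullet> v" if s: "t\<^sub>0 \<le> s" "s \<le> t\<^sub>0 + 3 * T" for s
  proof -
    have "exp (- K * (s - t\<^sub>0)) * (M - x k t\<^sub>0 \<bullet> v) + 0 / K * (1 - exp (- K * (s - t\<^sub>0))) \<le> M - x k s \<bullet> v"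
    proof (rule gap_lower_bound[OF \<open>0 \<le> t\<^sub>0\<close> hist k(1) order_refl s(1)])
      fix r assume r: "t\<^sub>0 < r" "r < s"
      have "0 \<le> M - x j (r - \<tau> r) \<bullet> v" if "j \<in> I" for j
        using below[OF that, of "r - \<tau> r"] delay[of r] r \<open>0 \<le> t\<^sub>0\<close> by auto
      then show "0 \<le> (\<Sum>j\<in>I - {k}. b k j r * (M - x j (r - \<tau> r) \<bullet> v))"
        using weight_nonneg[OF k(1)] r \<open>0 \<le> t\<^sub>0\<close> by (intro sum_nonneg mult_nonneg_nonneg) auto
    qed
    moreover have "exp (- K * (3 * T)) * (D / 2) \<le> exp (- K * (s - t\<^sub>0)) * (M - x k t\<^sub>0 \<bullet> v)"
      using s k(2) K_pos \<open>0 \<le> D\<close> by (intro mult_mono) auto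
    ultimately show ?thesis by (simp add: leader_gap_def)
  qed
  have "contraction * D \<le> M - x i t \<bullet> v"
  proof (cases "i = k")
    case True
    have "contraction * D \<le> leader_gap * D"
      using \<open>0 \<le> D\<close> by (intro mult_right_mono) (simp_all add: contraction_def)
    also have "\<dots> \<le> M - x i t \<bullet> v" using leader[of t] t T_pos True by simp
    finally show ?thesis .
  next
    case False
    (* The gap of i is propagated from t0 + T, beyond which r - \<tau> r \<ge> t0. *)
    define q where "q = t\<^sub>0 + T"
    have "exp (- K * (t - q)) * (M - x i q \<bullet> v)
        + \<beta> * (leader_gap * D) / K * (1 - exp (- K * (t - q))) \<le> M - x i t \<bullet> v"
    proof (rule gap_lower_bound[OF \<open>0 \<le> t\<^sub>0\<close> hist i(1)])
      show "t\<^sub>0 \<le> q" "q \<le> t" using t T_pos by (auto simp: q_def)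
      fix r assume r: "q < r" "r < t"
      then have "0 < r" using \<open>0 \<le> t\<^sub>0\<close> T_pos by (simp add: q_def)
      note d = delay[OF this]
      have "0 \<le> M - x j (r - \<tau> r) \<bullet> v" if "j \<in> I" for j
        using below[OF that, of "r - \<tau> r"] d r T_pos by (auto simp: q_def)
      then have nonneg: "0 \<le> b i j r * (M - x j (r - \<tau> r) \<bullet> v)" if "j \<in> I" for j
        using weight_nonneg[OF i(1) that \<open>0 < r\<close>] that by simp
      have "leader_gap * D \<le> M - x k (r - \<tau> r) \<bullet> v"
        using leader[of "r - \<tau> r"] d r t by (auto simp: q_def)
      then have "\<beta> * (leader_gap * D) \<le> b i k r * (M - x k (r - \<tau> r) \<bullet> v)"
        using weight_ge[OF i(1) k(1) False \<open>0 < r\<close>] weight_nonneg[OF i(1) k(1) \<open>0 < r\<close>] \<open>0 \<le> D\<close>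
        by (intro mult_mono) (auto simp: leader_gap_def)
      also have "\<dots> \<le> (\<Sum>j\<in>I - {i}. b i j r * (M - x j (r - \<tau> r) \<bullet> v))"
        by (rule member_le_sum) (use k False finite_I nonneg in auto)
      finally show "\<beta> * (leader_gap * D) \<le> (\<Sum>j\<in>I - {i}. b i j r * (M - x j (r - \<tau> r) \<bullet> v))" .
    qed
    moreover have "0 \<le> exp (- K * (t - q)) * (M - x i q \<bullet> v)"
      using below[OF i(1), of q] \<open>0 \<le> t\<^sub>0\<close> T_pos h_nonneg by (simp add: q_def)
    moreover have "contraction * D \<le> \<beta> * (leader_gap * D) / K * (1 - exp (- K * (t - q)))"
    proof -
      have "contraction * D \<le> (\<beta> * leader_gap / K * (1 - exp (- K * T))) * D"
        using \<open>0 \<le> D\<close> by (intro mult_right_mono) (simp_all add: contraction_def)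
      also have "\<dots> = \<beta> * (leader_gap * D) / K * (1 - exp (- K * T))" by simp
      also have "\<dots> \<le> \<beta> * (leader_gap * D) / K * (1 - exp (- K * (t - q)))"
        using t K_pos \<beta>_pos \<open>0 \<le> D\<close> by (intro mult_left_mono) (auto simp: q_def leader_gap_def)
      finally show ?thesis .
    qed
    ultimately show ?thesis by linarith
  qed
  then show ?thesis by simp
qed

lemma window_diameter_contraction:
  assumes diam: "window_diameter_le t\<^sub>0 D" and "0 \<le> t\<^sub>0"
  shows "window_diameter_le (t\<^sub>0 + 3 * T) ((1 - contraction) * D)"
  unfolding window_diameter_le_def
proof (intro ballI)
  fix i j s t assume i: "i \<in> I" and j: "j \<in> I"
    and s: "s \<in> window (t\<^sub>0 + 3 * T)" and t: "t \<in> window (t\<^sub>0 + 3 * T)"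
  have "0 \<le> norm (x i t\<^sub>0 - x i t\<^sub>0)" by simp
  also have "\<dots> \<le> D"
    using diam i window_mem[OF \<open>0 \<le> t\<^sub>0\<close>] unfolding window_diameter_le_def by blast
  finally have "0 \<le> D" .
  show "norm (x i s - x j t) \<le> (1 - contraction) * D"
  proof (rule norm_le_if_unit_projections_le)
    show "0 \<le> (1 - contraction) * D" using \<open>0 \<le> D\<close> contraction_le_half by simp
    fix v :: 'a assume nv: "norm v = 1"
    obtain M where M: "\<And>j s. j \<in> I \<Longrightarrow> s \<in> window t\<^sub>0 \<Longrightarrow> M - D \<le> x j s \<bullet> v"
      "\<And>j s. j \<in> I \<Longrightarrow> s \<in> window t\<^sub>0 \<Longrightarrow> x j s \<bullet> v \<le> M"
      using projection_range[OF diam nv \<open>0 \<le> t\<^sub>0\<close>] i by blast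
    have M': "x j s \<bullet> - v \<le> D - M" if "j \<in> I" "s \<in> window t\<^sub>0" for j s
      using M(1)[OF that] by simp
    have range: "- h \<le> r" "t\<^sub>0 - T \<le> r" if "r \<in> window (t\<^sub>0 + 3 * T)" for r
      using that T_pos by (auto simp: window_def)
    have upper: "x i s \<bullet> v \<le> M"
      by (rule projection_le[OF \<open>0 \<le> t\<^sub>0\<close> M(2) i range[OF s]])
    have lower: "x j t \<bullet> - v \<le> D - M"
      by (rule projection_le[OF \<open>0 \<le> t\<^sub>0\<close> M' j range[OF t]])
    (* Any single agent can serve as leader; agent i at time t0 is in the lower or the upper half of
       the range, and pulls the maximum down or, after reflection of v, the minimum up. *)
    show "(x i s - x j t) \<bullet> v \<le> (1 - contraction) * D"
    proof (cases "x i t\<^sub>0 \<bullet> v \<le> M - D / 2")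
      case True
      have "x i s \<bullet> v \<le> M - contraction * D"
        by (rule projection_contraction[OF \<open>0 \<le> t\<^sub>0\<close> \<open>0 \<le> D\<close> M(2) i True i s])
      then show ?thesis using lower by (simp add: inner_diff_left algebra_simps)
    next
      case False
      then have "x i t\<^sub>0 \<bullet> - v \<le> (D - M) - D / 2" by simp
      from projection_contraction[OF \<open>0 \<le> t\<^sub>0\<close> \<open>0 \<le> D\<close> M' i this j t]
      have "x j t \<bullet> - v \<le> (D - M) - contraction * D" .
      then show ?thesis using upper by (simp add: inner_diff_left algebra_simps)
    qed
  qed
qed

lemma window_diameter_geometric:
  assumes "window_diameter_le 0 D"
  shows "window_diameter_le (real n * (3 * T)) ((1 - contraction) ^ n * D)"
proof (induction n)
  case 0
  then show ?case using assms by simp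
next
  case (Suc n)
  have "window_diameter_le (real n * (3 * T) + 3 * T) ((1 - contraction) * ((1 - contraction) ^ n * D))"
    using Suc T_pos by (intro window_diameter_contraction) auto
  then show ?case by (simp add: algebra_simps)
qed

text \<open>
  A window bound persists by the maximum principle, so the last completed period controls the
  diameter at \<open>t\<close>; the factor \<open>exp contraction\<close> pays for the incomplete one.
\<close>

lemma diameter_exponential_decay:
  assumes "window_diameter_le 0 D" "i \<in> I" "j \<in> I" "0 \<le> t"
  shows "norm (x i t - x j t) \<le> D * exp contraction * exp (- (contraction / (3 * T)) * t)"
proof -
  have "0 \<le> norm (x i 0 - x j 0)" by simp
  also have "\<dots> \<le> D" using assms window_mem by (auto simp: window_diameter_le_def)
  finally have "0 \<le> D" .
  define n where "n = nat \<lfloor>t / (3 * T)\<rfloor>"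
  have n: "real n \<le> t / (3 * T)" "t / (3 * T) - 1 \<le> real n"
  proof -
    have "0 \<le> t / (3 * T)" using \<open>0 \<le> t\<close> T_pos by simp
    then show "real n \<le> t / (3 * T)" "t / (3 * T) - 1 \<le> real n"
      unfolding n_def by linarith+
  qed
  have "real n * (3 * T) \<le> t" using n(1) T_pos by (simp add: field_simps)
  then have "norm (x i t - x j t) \<le> (1 - contraction) ^ n * D"
    using T_pos assms by (intro window_diameter_le_later[OF window_diameter_geometric]) auto
  also have "(1 - contraction) ^ n \<le> exp (- contraction) ^ n"
    using contraction_le_half exp_ge_add_one_self[of "- contraction"] by (intro power_mono) auto
  also have "\<dots> = exp (- contraction * real n)"
    by (simp add: exp_of_nat_mult[symmetric] mult.commute)
  also have "\<dots> \<le> exp (contraction + - (contraction / (3 * T)) * t)"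
    using mult_left_mono[OF n(2), of contraction] contraction_pos by (simp add: algebra_simps)
  finally show ?thesis using \<open>0 \<le> D\<close> unfolding exp_add by (simp add: mult_right_mono mult_ac)
qed

end

section \<open>Exponential consensus in the delayed Hegselmann--Krause system\<close>

text \<open>
  Since \<open>\<psi> \<le> 1\<close>, the normalising sum in the second choice of rates is at most \<open>N\<close>, so that
  normalising only increases the rates; it also makes their mean over all agents equal to 1.
\<close>

lemma comm_rate_bounds:
  fixes x :: "nat \<Rightarrow> real \<Rightarrow> real ^ 'd"
  assumes pos: "\<And>r. 0 \<le> r \<Longrightarrow> 0 < \<psi> r" and anti: "antimono_on {0..} \<psi>" and one: "\<psi> 0 = 1"
    and N: "1 \<le> N" and rate: "a = comm_rate_A \<psi> \<tau> x \<or> a = comm_rate_B N \<psi> \<tau> x"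
    and j: "j \<in> {1..N}"
  shows comm_rate_ge: "\<psi> (norm (x j (t - \<tau> t) - x i t)) \<le> a i j t"
    and comm_rate_sum_le: "(\<Sum>k\<in>{1..N} - {i}. a i k t) \<le> N"
proof -
  define p where "p k = \<psi> (norm (x k (t - \<tau> t) - x i t))" for k
  define S where "S = (\<Sum>k = 1..N. p k)"
  have p_pos: "0 < p k" for k by (simp add: p_def pos)
  have p_le: "p k \<le> 1" for k
    using anti one monotone_onD[OF anti, of 0 "norm (x k (t - \<tau> t) - x i t)"] by (simp add: p_def)
  have S_pos: "0 < S" unfolding S_def using N p_pos by (intro sum_pos) auto
  have S_le: "S \<le> N" unfolding S_def using sum_bounded_above[of "{1..N}" p 1] p_le by simp
  consider "a = comm_rate_A \<psi> \<tau> x" | "a = comm_rate_B N \<psi> \<tau> x" using rate by blast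
  then have "p j \<le> a i j t \<and> (\<Sum>k\<in>{1..N} - {i}. a i k t) \<le> N"
  proof cases
    case 1
    have "(\<Sum>k\<in>{1..N} - {i}. p k) \<le> S"
      unfolding S_def using p_pos less_imp_le by (intro sum_mono2) auto
    then show ?thesis using 1 S_le by (simp add: comm_rate_A_def p_def)
  next
    case 2
    have a_eq: "a i k t = N * p k / S" for k
      by (simp add: 2 comm_rate_B_def p_def S_def)
    have "p j * S \<le> p j * N"
      using S_le p_pos[of j] by (intro mult_left_mono) auto
    then have "p j \<le> a i j t"
      using S_pos by (simp add: a_eq pos_le_divide_eq mult.commute)
    moreover have "(\<Sum>k\<in>{1..N} - {i}. p k) \<le> S"
      unfolding S_def using p_pos less_imp_le by (intro sum_mono2) auto
    then have "N * (\<Sum>k\<in>{1..N} - {i}. p k) / S \<le> N"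
      using S_pos by (simp add: pos_divide_le_eq mult_left_mono)
    ultimately show ?thesis
      by (simp add: a_eq sum_distrib_left sum_divide_distrib)
  qed
  then show "\<psi> (norm (x j (t - \<tau> t) - x i t)) \<le> a i j t" "(\<Sum>k\<in>{1..N} - {i}. a i k t) \<le> N"
    by (simp_all add: p_def)
qed

theorem theorem2p5:
  fixes N :: nat
    and lam c taubar R :: real
    and \<psi> \<tau> \<tau>' :: "real \<Rightarrow> real"
    and a :: "nat \<Rightarrow> nat \<Rightarrow> real \<Rightarrow> real"
    and x\<^sub>0 x :: "nat \<Rightarrow> real \<Rightarrow> real ^ 'd"
  assumes "N \<ge> 1"
    and "lam > 0"
    and "\<And>r. r \<ge> 0 \<Longrightarrow> \<psi> r > 0"
    and "antimono_on {0..} \<psi>"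
    and "\<psi> 0 = 1"
    and "W1inf_loc {0<..} \<tau> \<tau>'"
    and "continuous_on {0..} \<tau>"
    and "\<And>t. t > 0 \<Longrightarrow> 0 \<le> \<tau> t \<and> \<tau> t \<le> taubar"
    and "AE t in lebesgue_on {0<..}. \<tau>' t \<le> c"
    and "0 < c" and "c < 1"
    and "a = comm_rate_A \<psi> \<tau> x \<or> a = comm_rate_B N \<psi> \<tau> x"
    and "\<And>i. i \<in> {1..N} \<Longrightarrow> continuous_on {- \<tau> 0..0} (x\<^sub>0 i)"
    and "HK_solution N lam a \<tau> x\<^sub>0 x"
    and "R = initial_radius N \<tau> x"
    and "taubar < ln (1 + (\<psi> (2 * R)) ^ 3 / (2 + (\<psi> (2 * R)) ^ 2) * ((1 - c) / lam))"
  shows "\<exists>\<gamma> C. \<gamma> > 0 \<and> C > 0 \<and> (\<forall>t\<ge>0. opinion_diameter N x t \<le> C * exp (- \<gamma> * t))"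
proof -
  define I where "I = {1..N}"
  have \<tau>_lim: "(\<tau> \<longlongrightarrow> \<tau> 0) (at_right 0)"
    using \<open>continuous_on {0..} \<tau>\<close> unfolding continuous_on_def
    by (metis at_within_Ici_at_right atLeast_iff order_refl)
  have "\<forall>\<^sub>F t in at_right 0. 0 \<le> \<tau> t" "\<forall>\<^sub>F t in at_right 0. \<tau> t \<le> taubar"
    using assms(8) by (auto intro: eventually_at_rightI[of 0 1])
  then have \<tau>0: "0 \<le> \<tau> 0" "\<tau> 0 \<le> taubar"
    using \<tau>_lim by (auto intro: tendsto_lowerbound tendsto_upperbound)
  have x_cont: "continuous_on {- \<tau> 0..} (x i)" if "i \<in> I" for i
    using assms(14) that by (simp add: HK_solution_def I_def)
  have rate_ge: "\<psi> (norm (x j (t - \<tau> t) - x i t)) \<le> a i j t" if "j \<in> I" for i j t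
    using comm_rate_ge[of \<psi> N a \<tau> x j t i] assms that by (simp add: I_def)
  have rate_pos: "0 < a i j t" if "j \<in> I" for i j t
    using rate_ge[OF that] assms(3) by (meson less_le_trans norm_ge_zero)
  define b where "b i j t = lam / N * a i j t" for i j t
  (* taubar may be 0, whereas the length of the window has to be positive. *)
  interpret delayed_averaging I lam "taubar + 1" "\<tau> 0" \<tau> b x
  proof
    fix t :: real assume "0 < t"
    then show "0 \<le> \<tau> t \<and> \<tau> t \<le> taubar + 1 \<and> - \<tau> 0 \<le> t - \<tau> t"
      using assms(8)[of t] delayed_time_ge[of \<tau> \<tau>' c t] assms(6,7,9-11) by (auto simp: W1inf_loc_def)
    fix i assume i: "i \<in> I"
    show "(x i has_vector_derivative (\<Sum>j\<in>I - {i}. b i j t *\<^sub>R (x j (t - \<tau> t) - x i t))) (at t)"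
      using assms(14) i \<open>0 < t\<close> by (simp add: HK_solution_def I_def b_def scaleR_sum_right)
    show "(\<Sum>j\<in>I - {i}. b i j t) \<le> lam"
    proof -
      have "(\<Sum>j\<in>I - {i}. a i j t) \<le> N"
        unfolding I_def using assms by (intro comm_rate_sum_le[of \<psi> N a \<tau> x N]) auto
      then have "lam / N * (\<Sum>j\<in>I - {i}. a i j t) \<le> lam / N * N"
        using assms(2) by (intro mult_left_mono) auto
      then show ?thesis using assms(1) by (simp add: b_def sum_distrib_left)
    qed
    fix j assume "j \<in> I"
    then show "0 \<le> b i j t" using rate_pos[of j i t] assms(2) by (simp add: b_def)
  qed (use \<tau>0 assms x_cont in \<open>auto simp: I_def\<close>)
  (* The maximum principle alone confines all positions to a ball, which in turn bounds the
     distances and hence the weights from below. *)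
  have "\<exists>B. \<forall>s\<in>{- \<tau> 0..0}. norm (x i s) \<le> B" if "i \<in> I" for i
  proof -
    have "compact (x i ` {- \<tau> 0..0})"
      by (intro compact_continuous_image continuous_on_subset[OF x_cont[OF that]]) auto
    then show ?thesis by (meson bounded_iff compact_imp_bounded image_eqI)
  qed
  then obtain B where B: "\<And>i s. i \<in> I \<Longrightarrow> s \<in> {- \<tau> 0..0} \<Longrightarrow> norm (x i s) \<le> B i" by metis
  define \<rho> where "\<rho> = (\<Sum>i\<in>I. \<bar>B i\<bar>)"
  have init: "norm (x i s) \<le> \<rho>" if "i \<in> I" "s \<in> {- \<tau> 0..0}" for i s
  proof -
    have "norm (x i s) \<le> \<bar>B i\<bar>" using B[OF that] by simp
    also have "\<dots> \<le> \<rho>" unfolding \<rho>_def using that by (intro member_le_sum) (auto simp: I_def)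
    finally show ?thesis .
  qed
  have dist_le: "norm (x j s - x i t) \<le> 2 * \<rho>" if "i \<in> I" "j \<in> I" "- \<tau> 0 \<le> s" "- \<tau> 0 \<le> t" for i j s t
    using norm_le[OF init that(1,4)] norm_le[OF init that(2,3)] norm_triangle_ineq4[of "x j s" "x i t"]
    by simp
  have "0 \<le> \<rho>" by (simp add: \<rho>_def)
  interpret complete_delayed_averaging I lam "taubar + 1" "\<tau> 0" \<tau> b x "lam / N * \<psi> (2 * \<rho>)"
  proof
    show "0 < lam / N * \<psi> (2 * \<rho>)" using assms(1-3) \<open>0 \<le> \<rho>\<close> by simp
    fix i j and t :: real assume ij: "i \<in> I" "j \<in> I" "i \<noteq> j" and "0 < t"
    have "norm (x j (t - \<tau> t) - x i t) \<le> 2 * \<rho>"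
      using ij delay[OF \<open>0 < t\<close>] \<open>0 < t\<close> \<tau>0 by (intro dist_le) auto
    then have "\<psi> (2 * \<rho>) \<le> \<psi> (norm (x j (t - \<tau> t) - x i t))"
      using monotone_onD[OF assms(4), of "norm (x j (t - \<tau> t) - x i t)" "2 * \<rho>"] \<open>0 \<le> \<rho>\<close> by simp
    also have "\<dots> \<le> a i j t" by (rule rate_ge[OF ij(2)])
    finally show "lam / N * \<psi> (2 * \<rho>) \<le> b i j t"
      unfolding b_def using assms(2) by (intro mult_left_mono) auto
  qed
  have start: "window_diameter_le 0 (2 * \<rho>)"
    unfolding window_diameter_le_def
    by (auto simp: window_def intro!: dist_le)
  define \<gamma> where "\<gamma> = contraction / (3 * (taubar + 1))"
  (* The summand 1 makes C positive also if all initial data vanish. *)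
  define C where "C = 2 * \<rho> * exp contraction + 1"
  have "opinion_diameter N x t \<le> C * exp (- \<gamma> * t)" if "0 \<le> t" for t
  proof -
    have "norm (x i t - x j t) \<le> C * exp (- \<gamma> * t)" if "i \<in> I" "j \<in> I" for i j
    proof -
      have "norm (x i t - x j t) \<le> 2 * \<rho> * exp contraction * exp (- \<gamma> * t)"
        using diameter_exponential_decay[OF start that \<open>0 \<le> t\<close>] by (simp add: \<gamma>_def)
      also have "\<dots> \<le> C * exp (- \<gamma> * t)"
        by (intro mult_right_mono) (auto simp: C_def)
      finally show ?thesis .
    qed
    then show ?thesis
      unfolding opinion_diameter_def using assms(1) by (subst Max_le_iff) (auto simp: I_def)
  qed
  moreover have "0 < \<gamma>" using contraction_pos T_pos by (simp add: \<gamma>_def)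
  moreover have "0 < C" using \<open>0 \<le> \<rho>\<close> by (simp add: C_def add_nonneg_pos)
  ultimately show ?thesis by blast
qed

end
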